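(* Let $(X,E(X))$ be an infinite, connected, locally finite, non-oriented graph, $o\in X$, let $(X,P)$ be a random walk on $X$ and let $S$ be a subgraph of $X$ (with $S\cap B(o,n)\ne\emptyset$ for all $n$) such that $S$ is $L_o$-measurable and $L_o(S)>0$. If the restriction $F|_S$ of $F$ to the subgraph satisfies $L_o^S(F|_S)<1$ (in particular the limit $L_o^S(F|_S)$ exists), then $(X,P)$ is TOA.
   Context: A random walk $(X,P)$ is a Markov chain on $X$ with stochastic transition matrix $P$. $F(x,x)=\sum_{n\ge1}f^{(n)}(x,x)$, where $f^{(n)}(x,x)$ is the probability that the walk $(X,P)$ started at $x$ returns to $x$ for the first time at time $n$ (so $F$ is computed for the walk on all of $X$); $F|_S$ is the function $x\mapsto F(x,x)$ on $S$. $B(o,n)$ is the closed ball of centre $o$ and radius $n$. A set $S\subseteq X$ is $L_o$-measurable if $L_o(S)=\lim_n |S\cap B(o,n)|/|B(o,n)|$ exists. The rescaled limit on the average is $$L_o^S(g)=\lim_{n\to\infty}\frac1{|S\cap B(o,n)|}\sum_{x\in S\cap B(o,n)}g(x),\qquad g:S\to\mathbb R,$$ when this limit exists (defined for $S$ with $S\cap B(o,n)\neq\emptyset$ for all $n$). $(X,P)$ is TOA (transient on the average) if $\liminf_{n\to\infty}\frac1{|B(o,n)|}\sum_{x\in B(o,n)}F(x,x)<1$. *)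

theory Defs
  imports
    "HOL-Probability.Probability"
    "Graph_Theory.Digraph_Component"
    "Graph_Theory.Shortest_Path"
begin

text \<open>
  A non-oriented graph is a symmetric digraph whose edge set is a subset of the square of its
  vertex set (\<open>pair_sym_digraph\<close>); loops are allowed.
\<close>

definition locally_finite :: "'a pair_pre_digraph \<Rightarrow> bool" where
  "locally_finite G \<longleftrightarrow> (\<forall>x \<in> pverts G. finite (out_arcs (with_proj G) x))"

text \<open>
  The graph distance is the infimum of the numbers of edges of walks, i.e. the shortest-path
  distance for the weight that is constantly 1.
\<close>

definition graph_ball :: "'a pair_pre_digraph \<Rightarrow> 'a \<Rightarrow> nat \<Rightarrow> 'a set" where
  "graph_ball G c n =
     {x \<in> pverts G. wf_digraph.\<mu> (with_proj G) (\<lambda>_. 1) c x \<le> ereal (real n)}"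

text \<open>
  A stochastic matrix \<open>(p(x,y))\<close> is given by its rows: \<open>P x\<close> is the probability mass function
  \<open>y \<mapsto> p(x,y)\<close>, i.e. \<open>p(x,y) = pmf (P x) y\<close>. The rows belonging to points outside the vertex
  set are irrelevant. No relation between \<open>P\<close> and the edges is required.
\<close>

definition random_walk :: "'a pair_pre_digraph \<Rightarrow> ('a \<Rightarrow> 'a pmf) \<Rightarrow> bool" where
  "random_walk G P \<longleftrightarrow> (\<forall>x \<in> pverts G. set_pmf (P x) \<subseteq> pverts G)"

text \<open>
  \<open>walk_law P n x\<close> is the joint law of the positions at times \<open>0, \<dots>, n\<close> (a list of length
  \<open>n + 1\<close>) of the Markov chain with transition matrix \<open>P\<close> started at \<open>x\<close>.
\<close>

fun walk_law :: "('a \<Rightarrow> 'a pmf) \<Rightarrow> nat \<Rightarrow> 'a \<Rightarrow> 'a list pmf" where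
  "walk_law P 0 x = return_pmf [x]"
| "walk_law P (Suc n) x = bind_pmf (P x) (\<lambda>y. map_pmf (\<lambda>xs. x # xs) (walk_law P n y))"

text \<open>The following probability is only meaningful for \<open>n \<ge> 1\<close>.\<close>

definition first_return_prob :: "('a \<Rightarrow> 'a pmf) \<Rightarrow> nat \<Rightarrow> 'a \<Rightarrow> real" where
  "first_return_prob P n x =
     measure_pmf.prob (walk_law P n x) {xs. xs ! n = x \<and> (\<forall>i. 1 \<le> i \<and> i < n \<longrightarrow> xs ! i \<noteq> x)}"

text \<open>
  The sum over \<open>n \<ge> 1\<close>, hence the index shift. The series always converges, its terms being
  probabilities of disjoint events.
\<close>

definition return_prob :: "('a \<Rightarrow> 'a pmf) \<Rightarrow> 'a \<Rightarrow> real" where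
  "return_prob P x = (\<Sum>n. first_return_prob P (Suc n) x)"

definition ball_density :: "'a pair_pre_digraph \<Rightarrow> 'a \<Rightarrow> 'a set \<Rightarrow> nat \<Rightarrow> real" where
  "ball_density G c A n = real (card (A \<inter> graph_ball G c n)) / real (card (graph_ball G c n))"

definition L_measurable :: "'a pair_pre_digraph \<Rightarrow> 'a \<Rightarrow> 'a set \<Rightarrow> bool" where
  "L_measurable G c A \<longleftrightarrow> convergent (ball_density G c A)"

definition L_measure :: "'a pair_pre_digraph \<Rightarrow> 'a \<Rightarrow> 'a set \<Rightarrow> real" where
  "L_measure G c A = lim (ball_density G c A)"

definition ball_average ::
    "'a pair_pre_digraph \<Rightarrow> 'a \<Rightarrow> 'a set \<Rightarrow> ('a \<Rightarrow> real) \<Rightarrow> nat \<Rightarrow> real" where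
  "ball_average G c A g n =
     (\<Sum>x \<in> A \<inter> graph_ball G c n. g x) / real (card (A \<inter> graph_ball G c n))"

definition has_L_average :: "'a pair_pre_digraph \<Rightarrow> 'a \<Rightarrow> 'a set \<Rightarrow> ('a \<Rightarrow> real) \<Rightarrow> bool" where
  "has_L_average G c A g \<longleftrightarrow> convergent (ball_average G c A g)"

definition L_average :: "'a pair_pre_digraph \<Rightarrow> 'a \<Rightarrow> 'a set \<Rightarrow> ('a \<Rightarrow> real) \<Rightarrow> real" where
  "L_average G c A g = lim (ball_average G c A g)"

text \<open>
  The limit inferior is taken in the extended reals, where it always exists. Since
  \<open>graph_ball G c n\<close> consists of vertices, averaging over \<open>pverts G\<close> is averaging over the ball.
\<close>

definition transient_on_average ::
    "'a pair_pre_digraph \<Rightarrow> 'a \<Rightarrow> ('a \<Rightarrow> 'a pmf) \<Rightarrow> bool" where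
  "transient_on_average G c P \<longleftrightarrow>
     liminf (\<lambda>n. ereal (ball_average G c (pverts G) (return_prob P) n)) < 1"

end

theory Submission
  imports Defs
begin

text \<open>
  Since \<open>F \<le> 1\<close>, splitting the ball \<open>B\<close> into \<open>S \<inter> B\<close> and \<open>B - S\<close> shows that the average of \<open>F\<close>
  over \<open>B\<close> is at most \<open>1 - d (1 - a)\<close>, where \<open>d\<close> is the density of \<open>S\<close> in \<open>B\<close> and \<open>a\<close> the average
  of \<open>F\<close> over \<open>S \<inter> B\<close>. The limit of this bound is \<open>1 - L(S) (1 - L\<^sup>S(F)) < 1\<close>.
\<close>

text \<open>Consistency of the joint laws, which allows events at different times to be compared
  under one law. Both sides unfold along the first step of the walk, hence the arbitrary starting
  point in the induction.\<close>

lemma map_take_walk_law: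
  assumes "m \<le> n"
  shows "map_pmf (take (Suc m)) (walk_law P n x) = walk_law P m x"
  using assms
proof (induction m arbitrary: n x)
  case 0
  show ?case
    by (cases n) (simp_all add: map_bind_pmf map_pmf_comp)
next
  case (Suc m)
  then obtain k where n: "n = Suc k" "m \<le> k"
    by (cases n) auto
  have "map_pmf (\<lambda>xs. x # take (Suc m) xs) (walk_law P k y) =
        map_pmf ((#) x) (walk_law P m y)" for y
    using Suc.IH[OF n(2), of y, symmetric] by (simp add: map_pmf_comp)
  then show ?case
    by (simp add: n(1) map_bind_pmf map_pmf_comp)
qed

lemma first_return_prob_nonneg: "0 \<le> first_return_prob P n x"
  by (simp add: first_return_prob_def)

lemma first_return_prob_eq_walk_law:
  assumes "n \<le> N"
  shows "first_return_prob P n x =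
    measure_pmf.prob (walk_law P N x) {xs. xs ! n = x \<and> (\<forall>i. 1 \<le> i \<and> i < n \<longrightarrow> xs ! i \<noteq> x)}"
proof -
  \<comment> \<open>The event reads only entries with index at most \<open>n\<close>, so truncation
    does not affect it.\<close>
  have "take (Suc n) -` {xs. xs ! n = x \<and> (\<forall>i. 1 \<le> i \<and> i < n \<longrightarrow> xs ! i \<noteq> x)} =
        {xs. xs ! n = x \<and> (\<forall>i. 1 \<le> i \<and> i < n \<longrightarrow> xs ! i \<noteq> x)}"
    by auto
  then show ?thesis
    unfolding first_return_prob_def map_take_walk_law[OF assms, symmetric]
    by simp
qed

lemma sum_first_return_prob_le_1: "(\<Sum>n<N. first_return_prob P (Suc n) x) \<le> 1"
proof -
  define E where
    "E n = {xs. xs ! Suc n = x \<and> (\<forall>i. 1 \<le> i \<and> i < Suc n \<longrightarrow> xs ! i \<noteq> x)}" for n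
  \<comment> \<open>Index \<open>Suc m\<close> separates the events: the entry there is
    \<open>x\<close> on \<open>E m\<close> and differs from \<open>x\<close> on
    \<open>E n\<close>.\<close>
  have "E m \<inter> E n = {}" if "m < n" for m n
    using that by (force simp: E_def)
  then have disj: "disjoint_family_on E {..<N}"
    unfolding disjoint_family_on_def by (metis Int_commute linorder_neqE_nat)
  have "(\<Sum>n<N. first_return_prob P (Suc n) x) =
        (\<Sum>n<N. measure_pmf.prob (walk_law P N x) (E n))"
    by (intro sum.cong) (simp_all add: first_return_prob_eq_walk_law[of _ N] E_def)
  also have "\<dots> = measure_pmf.prob (walk_law P N x) (\<Union>n<N. E n)"
    using disj by (intro measure_pmf.finite_measure_finite_Union[symmetric]) auto
  also have "\<dots> \<le> 1"
    by (rule measure_pmf.prob_le_1)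
  finally show ?thesis .
qed

lemma return_prob_le_1: "return_prob P x \<le> 1"
  unfolding return_prob_def
  \<comment> \<open>The bound on partial sums serves twice: for summability, without which
    \<open>suminf\<close> says nothing, and for the value.\<close>
  by (intro suminf_le_const summableI_nonneg_bounded[where x = 1]
      first_return_prob_nonneg sum_first_return_prob_le_1)

lemma ball_average_le:
  assumes g: "\<And>x. g x \<le> 1" and dens: "ball_density G c A n \<noteq> 0"
  shows "ball_average G c (pverts G) g n \<le> 1 - ball_density G c A n * (1 - ball_average G c A g n)"
proof -
  define B where "B = graph_ball G c n"
  define D where "D = A \<inter> B"
  \<comment> \<open>A quotient with numerator or denominator 0 is 0 in HOL.\<close>
  have cards: "card D \<noteq> 0" "card B \<noteq> 0"
    using dens by (auto simp: ball_density_def B_def D_def)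
  \<comment> \<open>an infinite ball would have \<open>card\<close> equal to 0\<close>
  then have fin: "finite B" and sub: "D \<subseteq> B"
    by (auto simp: D_def intro: card_ge_0_finite)
  have "sum g B = sum g D + sum g (B - D)"
    using fin sub by (simp add: sum.subset_diff)
  also have "sum g (B - D) \<le> real (card (B - D))"
    using sum_bounded_above[of "B - D" g 1] g by simp
  also have "real (card (B - D)) = real (card B) - real (card D)"
    using fin sub by (simp add: card_Diff_subset finite_subset of_nat_diff card_mono)
  finally have "sum g B / card B \<le> (sum g D + (real (card B) - real (card D))) / card B"
    by (intro divide_right_mono) auto
  also have "\<dots> = 1 - card D / card B * (1 - sum g D / card D)"
    using cards by (simp add: field_simps)
  finally have "sum g B / card B \<le> 1 - card D / card B * (1 - sum g D / card D)" .
  moreover have "pverts G \<inter> B = B"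
    by (auto simp: B_def graph_ball_def)
  ultimately show ?thesis
    by (simp add: ball_average_def ball_density_def flip: B_def D_def)
qed

theorem corollary4p4:
  fixes X S :: "'a pair_pre_digraph" and c :: 'a and P :: "'a \<Rightarrow> 'a pmf"
  assumes "pair_sym_digraph X" and "infinite (pverts X)"
    and "connected (with_proj X)" and "locally_finite X"
    and "c \<in> pverts X"
    and "random_walk X P"
    and "pair_sym_digraph S" and "subgraph (with_proj S) (with_proj X)"
    and "\<forall>n. pverts S \<inter> graph_ball X c n \<noteq> {}"
    and "L_measurable X c (pverts S)" and "L_measure X c (pverts S) > 0"
    and "has_L_average X c (pverts S) (return_prob P)"
    and "L_average X c (pverts S) (return_prob P) < 1"
  shows "transient_on_average X c P"
proof -
  define d where "d = ball_density X c (pverts S)"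
  define a where "a = ball_average X c (pverts S) (return_prob P)"
  have d: "d \<longlonglongrightarrow> lim d" "0 < lim d"
    using assms(10,11)
    by (simp_all add: L_measurable_def L_measure_def d_def convergent_LIMSEQ_iff)
  have a: "a \<longlonglongrightarrow> lim a" "lim a < 1"
    using assms(12,13)
    by (simp_all add: has_L_average_def L_average_def a_def convergent_LIMSEQ_iff)
  \<comment> \<open>Since \<open>lim d\<close> is positive, \<open>d n\<close> is nonzero for all
    large \<open>n\<close>, as \<open>ball_average_le\<close> requires.\<close>
  have bound: "\<forall>\<^sub>F n in sequentially.
      ereal (ball_average X c (pverts X) (return_prob P) n) \<le> ereal (1 - d n * (1 - a n))"
    using order_tendstoD(1)[OF d]
  proof eventually_elim
    case (elim n)
    then show ?case
      using ball_average_le[where g = "return_prob P", OF return_prob_le_1, of X c "pverts S" n]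
      by (simp add: d_def a_def)
  qed
  have "(\<lambda>n. ereal (1 - d n * (1 - a n))) \<longlonglongrightarrow> ereal (1 - lim d * (1 - lim a))"
    by (intro tendsto_intros d a)
  then have lim: "liminf (\<lambda>n. ereal (1 - d n * (1 - a n))) = ereal (1 - lim d * (1 - lim a))"
    by (intro lim_imp_Liminf) simp_all
  \<comment> \<open>The averages over whole balls may fail to converge; an eventual upper bound
    suffices for \<open>liminf\<close>.\<close>
  have "liminf (\<lambda>n. ereal (ball_average X c (pverts X) (return_prob P) n)) \<le>
        ereal (1 - lim d * (1 - lim a))"
    using Liminf_mono[OF bound] lim by simp
  \<comment> \<open>Both factors \<open>lim d\<close> and \<open>1 - lim a\<close> are
    positive.\<close>
  also have "\<dots> < 1"
    using d(2) a(2) by simp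
  finally show ?thesis
    unfolding transient_on_average_def .
qed

end
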